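(* Let $\Lambda$ be the null linear functional on $C([0,1],\mathbb{C})$. Let $\mathcal{E}=\ker\Lambda$, let $\mathcal{F}=\{u\in \mathcal{E}\cap\mathcal{D} : u'\in \mathcal{E}\}$, where $\mathcal{D}$ is the space of continuously differentiable functions $[0,1]\to\mathbb{C}$, and let $T:\mathcal{F}\to \mathcal{E}$, $Tu=u'$. Then $\mathcal{E}=C([0,1],\mathbb{C})$ (hence $\mathcal{F}=\mathcal{D}$), $T$ is a closed operator, $\sigma(T)=\mathbb{C}$ and $\rho(T)=\emptyset$.
   Context: $C([0,1],\mathbb{C})$ carries the sup norm $\|f\|_\infty=\max_{x\in[0,1]}|f(x)|$. Functions in $\mathcal{D}$ are right-differentiable at $0$ and left-differentiable at $1$, with continuous derivative on $[0,1]$. A linear map $T:\mathcal{F}\to \mathcal{E}$ from a linear subspace $\mathcal{F}$ of a complex Banach space $\mathcal{E}$ is a closed operator if whenever $u_n\in \mathcal{F}$, $u_n\to u$ in $\mathcal{E}$ and $Tu_n\to v$ in $\mathcal{E}$, then $u\in \mathcal{F}$ and $v=Tu$; then $\mathcal{F}$ with the norm $N_1^T(u)=\|u\|+\|Tu\|$ is a Banach space. Let $J:\mathcal{F}\to \mathcal{E}$ be the canonical injection. For a closed $T$, $\zeta\in\mathbb{C}$ is in the resolvent set $\rho(T)$ if $\zeta J-T:\mathcal{F}\to \mathcal{E}$ has an inverse that is a bounded linear map from $\mathcal{E}$ to $(\mathcal{F},N_1^T)$; the spectrum is $\sigma(T)=\mathbb{C}\setminus\rho(T)$. *)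

theory Defs
  imports "HOL-Analysis.Analysis"
begin

section \<open>Complex Banach spaces\<close>

class scaleC =
  fixes scaleC :: "complex \<Rightarrow> 'a \<Rightarrow> 'a"  (infixr \<open>*\<^sub>C\<close> 75)

class complex_banach = banach + scaleC +
  assumes scaleC_add_right: "a *\<^sub>C (x + y) = a *\<^sub>C x + a *\<^sub>C y"
    and scaleC_add_left: "(a + b) *\<^sub>C x = a *\<^sub>C x + b *\<^sub>C x"
    and scaleC_scaleC: "a *\<^sub>C b *\<^sub>C x = (a * b) *\<^sub>C x"
    and scaleC_of_real: "complex_of_real r *\<^sub>C x = r *\<^sub>R x"
    and norm_scaleC: "norm (a *\<^sub>C x) = cmod a * norm x"

lemma scaleC_one: "1 *\<^sub>C x = (x :: 'a::complex_banach)"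
  using scaleC_of_real[of 1 x] by simp

global_interpretation complex_vector:
  vector_space "scaleC :: complex \<Rightarrow> 'a \<Rightarrow> 'a::complex_banach"
  by unfold_locales (auto simp: scaleC_add_right scaleC_add_left scaleC_scaleC scaleC_one)

instantiation complex :: complex_banach
begin

definition scaleC_complex :: "complex \<Rightarrow> complex \<Rightarrow> complex"
  where "scaleC_complex a x = a * x"

instance
  by standard (auto simp: scaleC_complex_def algebra_simps norm_mult scaleR_conv_of_real)

end

instance bcontfun :: (metric_space, banach) banach ..

instantiation bcontfun :: (metric_space, complex_banach) complex_banach
begin

definition scaleC_bcontfun :: "complex \<Rightarrow> ('a \<Rightarrow>\<^sub>C 'b) \<Rightarrow> ('a \<Rightarrow>\<^sub>C 'b)"
  where "scaleC_bcontfun a f = Bcontfun (\<lambda>x. a *\<^sub>C f x)"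

lemma bounded_linear_scaleC: "bounded_linear (\<lambda>x :: 'b. a *\<^sub>C x)"
proof (rule bounded_linear_intro[where K = "cmod a"])
  fix x y :: 'b and r :: real
  show "a *\<^sub>C (x + y) = a *\<^sub>C x + a *\<^sub>C y"
    by (rule scaleC_add_right)
  show "a *\<^sub>C (r *\<^sub>R x) = r *\<^sub>R (a *\<^sub>C x)"
    by (simp only: scaleC_of_real[symmetric] scaleC_scaleC mult.commute)
  show "norm (a *\<^sub>C x) \<le> norm x * cmod a"
    by (simp only: norm_scaleC mult.commute order.refl)
qed

lemma scaleC_bcontfun_apply [simp]: "(a *\<^sub>C f) x = a *\<^sub>C (f x)"
  for f :: "'a \<Rightarrow>\<^sub>C 'b"
proof -
  have "(\<lambda>x. a *\<^sub>C f x) \<in> bcontfun"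
    unfolding bcontfun_def
    using bounded_linear_image[OF bounded_apply_bcontfun[of f] bounded_linear_scaleC[of a]]
    by (auto simp: image_comp o_def
        intro!: bounded_linear.continuous_on[OF bounded_linear_scaleC])
  then show ?thesis
    by (simp add: scaleC_bcontfun_def Bcontfun_inverse)
qed

instance
proof
  fix a b :: complex and r :: real and f g :: "'a \<Rightarrow>\<^sub>C 'b"
  show "a *\<^sub>C (f + g) = a *\<^sub>C f + a *\<^sub>C g"
    by (rule bcontfun_eqI) (simp add: scaleC_add_right)
  show "(a + b) *\<^sub>C f = a *\<^sub>C f + b *\<^sub>C f"
    by (rule bcontfun_eqI) (simp add: scaleC_add_left)
  show "a *\<^sub>C b *\<^sub>C f = (a * b) *\<^sub>C f"
    by (rule bcontfun_eqI) simp
  show "complex_of_real r *\<^sub>C f = r *\<^sub>R f"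
    by (rule bcontfun_eqI) (simp add: scaleC_of_real)
  have le: "norm (c *\<^sub>C h) \<le> cmod c * norm h" for c and h :: "'a \<Rightarrow>\<^sub>C 'b"
    by (rule norm_bound) (simp add: norm_scaleC mult_left_mono norm_bounded)
  show "norm (a *\<^sub>C f) = cmod a * norm f"
  proof (cases "a = 0")
    case True
    then show ?thesis using le[of a f] by simp
  next
    case False
    have "inverse a *\<^sub>C a *\<^sub>C f = f"
      by (rule bcontfun_eqI) (simp add: False)
    then have "norm f \<le> cmod (inverse a) * norm (a *\<^sub>C f)"
      using le[of "inverse a" "a *\<^sub>C f"] by simp
    then have "cmod a * norm f \<le> cmod a * (cmod (inverse a) * norm (a *\<^sub>C f))"
      by (rule mult_left_mono) simp
    also have "\<dots> = norm (a *\<^sub>C f)"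
      using False by (simp add: mult.assoc[symmetric] norm_mult[symmetric])
    finally have "cmod a * norm f \<le> norm (a *\<^sub>C f)" .
    then show ?thesis using le[of a f] by simp
  qed
qed

end


section \<open>Closed operators and their spectrum\<close>

text \<open>
  The space \<open>E\<close> is a Banach subspace of the ambient type, and only the values of \<open>T\<close> on \<open>F\<close> matter.
\<close>

definition linear_op_on :: "'a::complex_banach set \<Rightarrow> ('a \<Rightarrow> 'a) \<Rightarrow> bool"
  where "linear_op_on F T \<longleftrightarrow>
    (\<forall>u\<in>F. \<forall>v\<in>F. T (u + v) = T u + T v) \<and> (\<forall>c. \<forall>u\<in>F. T (c *\<^sub>C u) = c *\<^sub>C T u)"

definition closed_operator ::
    "'a::complex_banach set \<Rightarrow> 'a set \<Rightarrow> ('a \<Rightarrow> 'a) \<Rightarrow> bool"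
  where "closed_operator E F T \<longleftrightarrow>
    complex_vector.subspace E \<and> complete E \<and>
    complex_vector.subspace F \<and> F \<subseteq> E \<and> T ` F \<subseteq> E \<and> linear_op_on F T \<and>
    (\<forall>U. \<forall>u\<in>E. \<forall>v\<in>E. (\<forall>n::nat. U n \<in> F) \<longrightarrow> U \<longlonglongrightarrow> u \<longrightarrow> (\<lambda>n. T (U n)) \<longlonglongrightarrow> v \<longrightarrow>
       u \<in> F \<and> v = T u)"

definition graph_norm :: "('a::complex_banach \<Rightarrow> 'a) \<Rightarrow> 'a \<Rightarrow> real"
  where "graph_norm T u = norm u + norm (T u)"

definition resolvent_set ::
    "'a::complex_banach set \<Rightarrow> 'a set \<Rightarrow> ('a \<Rightarrow> 'a) \<Rightarrow> complex set"
  where "resolvent_set E F T = {\<zeta>. \<exists>R.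
    R ` E \<subseteq> F \<and> linear_op_on E R \<and>
    (\<exists>K. \<forall>v\<in>E. graph_norm T (R v) \<le> K * norm v) \<and>
    (\<forall>v\<in>E. \<zeta> *\<^sub>C R v - T (R v) = v) \<and>
    (\<forall>u\<in>F. R (\<zeta> *\<^sub>C u - T u) = u)}"

definition spectrum_op ::
    "'a::complex_banach set \<Rightarrow> 'a set \<Rightarrow> ('a \<Rightarrow> 'a) \<Rightarrow> complex set"
  where "spectrum_op E F T = - resolvent_set E F T"


section \<open>Continuous functions on the unit interval\<close>

typedef unit_interval = "{0..1::real}"
  morphisms ui_real ui_of_real
  by (rule exI[of _ 0]) simp

instantiation unit_interval :: metric_space
begin

definition dist_unit_interval :: "unit_interval \<Rightarrow> unit_interval \<Rightarrow> real"
  where "dist_unit_interval s t = dist (ui_real s) (ui_real t)"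

definition uniformity_unit_interval :: "(unit_interval \<times> unit_interval) filter"
  where "uniformity_unit_interval = (INF e\<in>{0<..}. principal {(s, t). dist s t < e})"

definition open_unit_interval :: "unit_interval set \<Rightarrow> bool"
  where "open_unit_interval S \<longleftrightarrow> (\<forall>s\<in>S. \<forall>\<^sub>F (s', t) in uniformity. s' = s \<longrightarrow> t \<in> S)"

instance
proof
  show "uniformity = (INF e\<in>{0<..}. principal {(s, t :: unit_interval). dist s t < e})"
    by (rule uniformity_unit_interval_def)
  show "open S \<longleftrightarrow> (\<forall>s\<in>S. \<forall>\<^sub>F (s', t) in uniformity. s' = s \<longrightarrow> t \<in> S)"
    for S :: "unit_interval set"
    by (rule open_unit_interval_def)
  show "dist s t = 0 \<longleftrightarrow> s = t" for s t :: unit_interval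
    by (simp add: dist_unit_interval_def ui_real_inject)
  show "dist s t \<le> dist s r + dist t r" for s t r :: unit_interval
    unfolding dist_unit_interval_def by (rule dist_triangle2)
qed

end

lemma continuous_on_ui_of_real: "continuous_on {0..1} ui_of_real"
  unfolding continuous_on_iff dist_unit_interval_def
proof (intro ballI allI impI)
  fix x :: real and e :: real
  assume "x \<in> {0..1}" "0 < e"
  then show "\<exists>d>0. \<forall>x'\<in>{0..1}. dist x' x < d \<longrightarrow> dist (ui_real (ui_of_real x')) (ui_real (ui_of_real x)) < e"
    by (intro exI[of _ e]) (simp add: ui_of_real_inverse)
qed

lemma continuous_on_ui_real: "continuous_on UNIV ui_real"
  unfolding continuous_on_iff dist_unit_interval_def by blast

lemma compact_unit_interval: "compact (UNIV :: unit_interval set)"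
proof -
  have "UNIV = ui_of_real ` {0..1}"
    using ui_real ui_real_inverse by (metis UNIV_eq_I image_eqI)
  then show ?thesis
    using compact_continuous_image[OF continuous_on_ui_of_real compact_Icc] by simp
qed

text \<open>
  Since the unit interval is compact, the bounded continuous functions on it are all the
  continuous ones, and their norm is the maximum of the modulus.
\<close>

type_synonym C01 = "unit_interval \<Rightarrow>\<^sub>C complex"

lemma continuous_imp_bcontfun:
  fixes f :: "unit_interval \<Rightarrow> complex"
  assumes "continuous_on UNIV f"
  shows "f \<in> bcontfun"
  unfolding bcontfun_def
  using assms compact_imp_bounded[OF compact_continuous_image[OF assms compact_unit_interval]]
  by blast

text \<open>
  Values of \<open>on_reals u\<close> outside \<open>[0,1]\<close> are unspecified, but they are irrelevant for
  derivatives \<open>at t within {0..1}\<close>, which are one-sided at the end points.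
\<close>

definition on_reals :: "C01 \<Rightarrow> real \<Rightarrow> complex"
  where "on_reals u t = u (ui_of_real t)"

definition deriv01 :: "C01 \<Rightarrow> real \<Rightarrow> complex"
  where "deriv01 u t = vector_derivative (on_reals u) (at t within {0..1})"

definition C1_space :: "C01 set"
  where "C1_space = {u. on_reals u differentiable_on {0..1} \<and> continuous_on {0..1} (deriv01 u)}"

text \<open>\<open>diff_op u\<close> is the function \<open>u'\<close>; it is meaningful only for \<open>u \<in> C1_space\<close>.\<close>

definition diff_op :: "C01 \<Rightarrow> C01"
  where "diff_op u = Bcontfun (\<lambda>s. deriv01 u (ui_real s))"

lemma diff_op_apply:
  assumes "u \<in> C1_space"
  shows "diff_op u s = deriv01 u (ui_real s)"
proof -
  have "range ui_real \<subseteq> {0..1}"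
    using ui_real by blast
  moreover have "continuous_on {0..1} (deriv01 u)"
    using assms by (simp add: C1_space_def)
  ultimately have "continuous_on UNIV (\<lambda>s. deriv01 u (ui_real s))"
    using continuous_on_compose2 continuous_on_ui_real by blast
  then show ?thesis
    by (simp add: diff_op_def Bcontfun_inverse[OF continuous_imp_bcontfun])
qed

definition ker_space :: "(C01 \<Rightarrow> complex) \<Rightarrow> C01 set"
  where "ker_space \<Lambda> = {u. \<Lambda> u = 0}"

definition dom_space :: "(C01 \<Rightarrow> complex) \<Rightarrow> C01 set"
  where "dom_space \<Lambda> = {u \<in> ker_space \<Lambda> \<inter> C1_space. diff_op u \<in> ker_space \<Lambda>}"

end

theory Submission
  imports Defs
begin

text \<open>
  Closedness is the theorem on uniform convergence of derivatives. Every complex \<open>\<zeta>\<close> is an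
  eigenvalue, with eigenfunction \<open>exp (\<zeta> t)\<close>, so that \<open>\<zeta> - T\<close> is never injective.
\<close>

lemma on_reals_ui_real [simp]: "on_reals u (ui_real s) = u s"
  by (simp add: on_reals_def ui_real_inverse)

lemma continuous_on_on_reals: "continuous_on {0..1} (on_reals u)"
  unfolding on_reals_def
  by (rule continuous_on_compose2[OF _ continuous_on_ui_of_real, of UNIV])
     (auto intro: continuous_intros)

text \<open>One pointwise derivative statement gives both membership in \<open>C1_space\<close> and
  the value of \<open>diff_op\<close>, so the usual derivative rules settle both at once below.
  Continuity of the derivative is built into the right-hand side, because \<open>v\<close> is itself
  an element of \<open>C01\<close>.\<close>

lemma C1_space_diff_op_iff:
  "u \<in> C1_space \<and> diff_op u = v \<longleftrightarrow>
    (\<forall>t\<in>{0..1}. (on_reals u has_vector_derivative on_reals v t) (at t within {0..1}))"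
proof (intro iffI ballI)
  fix t :: real
  assume u: "u \<in> C1_space \<and> diff_op u = v" and t: "t \<in> {0..1}"
  have "on_reals u differentiable (at t within {0..1})"
    using u t by (simp add: C1_space_def differentiable_on_def)
  then have "(on_reals u has_vector_derivative deriv01 u t) (at t within {0..1})"
    unfolding deriv01_def by (simp add: vector_derivative_works)
  moreover have "deriv01 u t = on_reals v t"
    using diff_op_apply[of u "ui_of_real t"] u t by (auto simp: on_reals_def ui_of_real_inverse)
  ultimately show "(on_reals u has_vector_derivative on_reals v t) (at t within {0..1})"
    by simp
next
  assume D: "\<forall>t\<in>{0..1}. (on_reals u has_vector_derivative on_reals v t) (at t within {0..1})"
  \<comment> \<open>Derivatives within a nondegenerate interval are unique, also at its end points,
    so \<open>vector_derivative\<close> selects the given one.\<close>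
  have deriv: "deriv01 u t = on_reals v t" if "t \<in> {0..1}" for t
    unfolding deriv01_def
    using vector_derivative_within_cbox[of 0 1 t "on_reals u" "on_reals v t"] D that by simp
  have "on_reals u differentiable_on {0..1}"
    using D by (auto simp: differentiable_on_def intro: differentiableI_vector)
  moreover have "continuous_on {0..1} (deriv01 u)"
    using continuous_on_on_reals[of v] deriv continuous_on_cong by metis
  ultimately have u: "u \<in> C1_space"
    by (simp add: C1_space_def)
  moreover have "diff_op u = v"
    by (rule bcontfun_eqI) (use u deriv ui_real in \<open>simp add: diff_op_apply\<close>)
  ultimately show "u \<in> C1_space \<and> diff_op u = v" ..
qed

lemma has_vector_derivative_on_reals:
  assumes "u \<in> C1_space" "t \<in> {0..1}"
  shows "(on_reals u has_vector_derivative on_reals (diff_op u) t) (at t within {0..1})"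
  using C1_space_diff_op_iff[of u "diff_op u"] assms by blast

lemma on_reals_add: "on_reals (u + v) = (\<lambda>t. on_reals u t + on_reals v t)"
  and on_reals_scaleC: "on_reals (c *\<^sub>C u) = (\<lambda>t. c * on_reals u t)"
  by (auto simp: on_reals_def scaleC_complex_def)

lemma diff_op_add:
  assumes "u \<in> C1_space" "v \<in> C1_space"
  shows "u + v \<in> C1_space \<and> diff_op (u + v) = diff_op u + diff_op v"
  unfolding C1_space_diff_op_iff on_reals_add
  using assms by (auto intro!: has_vector_derivative_add has_vector_derivative_on_reals)

lemma diff_op_scaleC:
  assumes "u \<in> C1_space"
  shows "c *\<^sub>C u \<in> C1_space \<and> diff_op (c *\<^sub>C u) = c *\<^sub>C diff_op u"
  unfolding C1_space_diff_op_iff on_reals_scaleC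
  using assms by (auto intro!: has_vector_derivative_mult_right has_vector_derivative_on_reals)

lemma zero_in_C1_space: "0 \<in> C1_space"
proof -
  have "on_reals 0 = (\<lambda>t. 0)"
    by (simp add: on_reals_def fun_eq_iff)
  then show ?thesis
    using C1_space_diff_op_iff[of 0 0] by simp
qed

text \<open>The sup distance dominates the distance of the values at every point.\<close>

lemma tendsto_on_reals:
  assumes "U \<longlonglongrightarrow> u"
  shows "(\<lambda>n. on_reals (U n) t) \<longlonglongrightarrow> on_reals u t"
  unfolding on_reals_def
  using assms dist_bounded by (blast intro: metric_tendsto_imp_tendsto always_eventually)

text \<open>Convergence in \<open>C01\<close> is uniform, so the derivatives converge uniformly to
  \<open>v\<close>, while the functions converge at least at one point; hence the limit function is
  differentiable with derivative \<open>v\<close>.\<close>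

lemma diff_op_closed:
  assumes U: "\<And>n. U n \<in> C1_space"
    and u: "U \<longlonglongrightarrow> u" and v: "(\<lambda>n. diff_op (U n)) \<longlonglongrightarrow> v"
  shows "u \<in> C1_space \<and> diff_op u = v"
proof -
  have "\<exists>g. \<forall>t\<in>{0..1}. (\<lambda>n. on_reals (U n) t) \<longlonglongrightarrow> g t \<and>
      (g has_derivative (\<lambda>h. h *\<^sub>R on_reals v t)) (at t within {0..1})"
  proof (rule has_derivative_sequence)
    show "(on_reals (U n) has_derivative (\<lambda>h. h *\<^sub>R on_reals (diff_op (U n)) t)) (at t within {0..1})"
      if "t \<in> {0..1}" for n t
      using has_vector_derivative_on_reals[OF U that] by (simp add: has_vector_derivative_def)
    show "\<forall>\<^sub>F n in sequentially. \<forall>t\<in>{0..1}. \<forall>h.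
        norm (h *\<^sub>R on_reals (diff_op (U n)) t - h *\<^sub>R on_reals v t) \<le> e * norm h"
      if "0 < e" for e
      using tendstoD[OF v that]
    proof eventually_elim
      case (elim n)
      have le: "norm (on_reals (diff_op (U n)) t - on_reals v t) \<le> e" for t
        using dist_bounded[of "diff_op (U n)" "ui_of_real t" v] elim
        by (simp add: on_reals_def dist_norm)
      then show ?case
        using mult_left_mono[OF le abs_ge_zero]
        by (simp add: scaleR_diff_right[symmetric] mult.commute)
    qed
    \<comment> \<open>The theorem asks for convergence of the functions at a single point; 0 serves
      as that point.\<close>
    show "(\<lambda>n. on_reals (U n) 0) \<longlonglongrightarrow> on_reals u 0"
      by (rule tendsto_on_reals[OF u])
  qed auto
  then obtain g where lim: "\<And>t. t \<in> {0..1} \<Longrightarrow> (\<lambda>n. on_reals (U n) t) \<longlonglongrightarrow> g t"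
    and g: "\<And>t. t \<in> {0..1} \<Longrightarrow> (g has_vector_derivative on_reals v t) (at t within {0..1})"
    unfolding has_vector_derivative_def by blast
  \<comment> \<open>The function \<open>g\<close> is only known to exist; uniqueness of pointwise
    limits identifies it with \<open>u\<close> on the interval.\<close>
  have "g t = on_reals u t" if "t \<in> {0..1}" for t
    using LIMSEQ_unique[OF lim[OF that] tendsto_on_reals[OF u]] .
  then show ?thesis
    unfolding C1_space_diff_op_iff using g by (metis has_vector_derivative_transform)
qed

lemma closed_operator_diff_op: "closed_operator UNIV C1_space diff_op"
proof -
  have "complex_vector.subspace C1_space"
    by (simp add: complex_vector.subspace_def zero_in_C1_space diff_op_add diff_op_scaleC)
  moreover have "linear_op_on C1_space diff_op"
    by (simp add: linear_op_on_def diff_op_add diff_op_scaleC)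
  ultimately show ?thesis
    unfolding closed_operator_def
    by (simp add: complete_UNIV complex_vector.subspace_UNIV) (metis diff_op_closed)
qed

lemma diff_op_eigenfunction: "\<exists>u\<in>C1_space. u \<noteq> 0 \<and> diff_op u = \<zeta> *\<^sub>C u"
proof -
  define u :: C01 where "u = Bcontfun (\<lambda>s. exp (\<zeta> * of_real (ui_real s)))"
  have "u s = exp (\<zeta> * of_real (ui_real s))" for s
    unfolding u_def
    \<comment> \<open>Boundedness comes from continuity on the compact unit interval.\<close>
    by (subst Bcontfun_inverse)
       (auto intro!: continuous_imp_bcontfun continuous_intros continuous_on_ui_real)
  then have u: "on_reals u t = exp (\<zeta> * of_real t)" if "t \<in> {0..1}" for t
    using that by (simp add: on_reals_def ui_of_real_inverse)
  \<comment> \<open>The complex derivative of \<open>exp (\<zeta> * z)\<close> is restricted to the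
    real line.\<close>
  have "((\<lambda>t. exp (\<zeta> * of_real t)) has_vector_derivative \<zeta> * exp (\<zeta> * of_real t))
      (at t within {0..1})" for t :: real
    by (rule has_vector_derivative_eq_rhs,
        rule has_vector_derivative_real_field[where f = "\<lambda>z. exp (\<zeta> * z)"])
       (auto intro!: derivative_eq_intros)
  \<comment> \<open>Since \<open>on_reals u\<close> is known to equal the exponential only on the
    unit interval, the derivative is transferred within that set.\<close>
  then have "(on_reals u has_vector_derivative on_reals (\<zeta> *\<^sub>C u) t) (at t within {0..1})"
    if "t \<in> {0..1}" for t
    using has_vector_derivative_transform[OF that u] that u by (simp add: on_reals_scaleC)
  then have "u \<in> C1_space \<and> diff_op u = \<zeta> *\<^sub>C u"
    unfolding C1_space_diff_op_iff by blast
  \<comment> \<open>The value of \<open>u\<close> at 0 is 1.\<close>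
  moreover have "u \<noteq> 0"
    using u[of 0] by (auto simp: on_reals_def)
  ultimately show ?thesis
    by blast
qed

text \<open>A resolvent \<open>R\<close> is a linear left inverse of \<zeta> - \<open>T\<close>,
  which sends the eigenvector \<open>u\<close> to 0; so \<open>R 0\<close> would be both 0 and
  \<open>u\<close>.\<close>

lemma eigenvalue_not_in_resolvent_set:
  assumes "0 \<in> E" "u \<in> F" "u \<noteq> 0" "T u = \<zeta> *\<^sub>C u"
  shows "\<zeta> \<notin> resolvent_set E F T"
proof
  assume "\<zeta> \<in> resolvent_set E F T"
  then obtain R where lin: "linear_op_on E R" and inv: "\<forall>u\<in>F. R (\<zeta> *\<^sub>C u - T u) = u"
    unfolding resolvent_set_def by blast
  \<comment> \<open>Homogeneity with scalar 0, applied at the vector 0 of \<open>E\<close>, yields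
    \<open>R 0 = 0\<close>.\<close>
  have "R (0 *\<^sub>C 0) = 0 *\<^sub>C R 0"
    using lin \<open>0 \<in> E\<close> unfolding linear_op_on_def by blast
  moreover have "R 0 = u"
    using bspec[OF inv \<open>u \<in> F\<close>] assms(4) by simp
  ultimately show False
    using \<open>u \<noteq> 0\<close> by simp
qed

theorem mainTheorem1:
  fixes \<Lambda> :: "C01 \<Rightarrow> complex"
  assumes "\<Lambda> = (\<lambda>f. 0)"
  shows "ker_space \<Lambda> = (UNIV :: C01 set) \<and>
    dom_space \<Lambda> = C1_space \<and>
    closed_operator (ker_space \<Lambda>) (dom_space \<Lambda>) diff_op \<and>
    spectrum_op (ker_space \<Lambda>) (dom_space \<Lambda>) diff_op = (UNIV :: complex set) \<and>
    resolvent_set (ker_space \<Lambda>) (dom_space \<Lambda>) diff_op = {}"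
proof -
  have ker: "ker_space \<Lambda> = UNIV"
    using assms by (simp add: ker_space_def)
  then have dom: "dom_space \<Lambda> = C1_space"
    by (simp add: dom_space_def)
  have "resolvent_set UNIV C1_space diff_op = {}"
    using diff_op_eigenfunction eigenvalue_not_in_resolvent_set[OF UNIV_I] by blast
  then show ?thesis
    by (simp add: ker dom closed_operator_diff_op spectrum_op_def)
qed

end
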